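(* Let $\mathcal{H}$ be a complex Hilbert space, let $0\le\theta<\frac{\pi}{2}$, and let $A\in\mathcal{B}(\mathcal{H})$ be such that $W(A)\subset S_\theta$. Then for any $0\le t\le 1$, \[\left(2\sqrt{(1-t)^3}\cos(\theta)\right)\|A\|+\left|\,\left\|\sqrt{(1-t)^3}\,\mathfrak{R}A+\sqrt{t^3}\,\mathfrak{I}A\right\|-\left\|\sqrt{(1-t)^3}\,\mathfrak{R}A-\sqrt{t^3}\,\mathfrak{I}A\right\|\,\right|\le\omega_t(A).\] In particular, \[\frac{\cos(\theta)}{\sqrt2}\|A\|+\frac{1}{2\sqrt2}\left|\,\left\|\mathfrak{R}A+\mathfrak{I}A\right\|-\left\|\mathfrak{R}A-\mathfrak{I}A\right\|\,\right|\le\omega(A).\] Consequently, if $0\le\theta\le\frac{\pi}{4}$, then \[\begin{aligned} \frac12\|A\|&\le\frac12\|A\|+\frac{1}{2\sqrt2}\left|\,\left\|\mathfrak{R}A+\mathfrak{I}A\right\|-\left\|\mathfrak{R}A-\mathfrak{I}A\right\|\,\right|\\ &\le\frac{\cos(\theta)}{\sqrt2}\|A\|+\frac{1}{2\sqrt2}\left|\,\left\|\mathfrak{R}A+\mathfrak{I}A\right\|-\left\|\mathfrak{R}A-\mathfrak{I}A\right\|\,\right|\\ &\le\omega(A). \end{aligned}\]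
   Context: $\mathcal{B}(\mathcal{H})$ is the $C^*$-algebra of bounded linear operators on the complex Hilbert space $\mathcal{H}$, with operator norm $\|\cdot\|$. $\mathfrak{R}A=\frac{A+A^*}{2}$ and $\mathfrak{I}A=\frac{A-A^*}{2\mathrm{i}}$. The numerical range is $W(A)=\{\langle Ax,x\rangle: x\in\mathcal{H},\ \|x\|=1\}$, and the numerical radius is $\omega(A)=\sup_{\|x\|=1}|\langle Ax,x\rangle|$. For $0\le t\le 1$, the $t$-weighted numerical radius of $A$ is $\omega_t(A)=\omega\left((1-2t)A^*+A\right)$. For $0\le\theta<\frac{\pi}{2}$, $S_\theta=\{z\in\mathbb{C}:\operatorname{Re}z>0,\ |\operatorname{Im}z|\le\tan(\theta)\operatorname{Re}z\}$. *)

theory Defs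
  imports "HOL-Analysis.Analysis"
begin

(* The inner product is linear in its first argument, and the norm, distance and
   topology are those it induces. The real scaling inherited from real_normed_vector
   is the restriction of the complex one. *)

class complex_inner = real_normed_vector +
  fixes scaleC :: "complex \<Rightarrow> 'a \<Rightarrow> 'a"  (infixr "*\<^sub>C" 75)
    and cinner :: "'a \<Rightarrow> 'a \<Rightarrow> complex"
  assumes scaleC_add_right: "c *\<^sub>C (x + y) = c *\<^sub>C x + c *\<^sub>C y"
    and scaleC_add_left: "(c + d) *\<^sub>C x = c *\<^sub>C x + d *\<^sub>C x"
    and scaleC_scaleC: "c *\<^sub>C (d *\<^sub>C x) = (c * d) *\<^sub>C x"
    and scaleR_eq_scaleC: "r *\<^sub>R x = complex_of_real r *\<^sub>C x"
    and cinner_commute: "cinner x y = cnj (cinner y x)"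
    and cinner_add_left: "cinner (x + y) z = cinner x z + cinner y z"
    and cinner_scaleC_left: "cinner (c *\<^sub>C x) y = c * cinner x y"
    and cinner_ge_zero: "0 \<le> Re (cinner x x)"
    and cinner_eq_zero_iff: "cinner x x = 0 \<longleftrightarrow> x = 0"
    and norm_eq_sqrt_cinner: "norm x = sqrt (Re (cinner x x))"

class chilbert_space = complex_inner + complete_space

(* An operator is a function satisfying bounded_clinear; its operator norm is onorm.
   For a complex-linear operator, boundedness and operator norm do not depend on
   whether the space is viewed as a real or a complex normed space. *)

definition bounded_clinear :: "('a::complex_inner \<Rightarrow> 'a) \<Rightarrow> bool" where
  "bounded_clinear A \<longleftrightarrow> bounded_linear A \<and> (\<forall>c x. A (c *\<^sub>C x) = c *\<^sub>C A x)"

(* For a bounded operator on a Hilbert space, exactly one B has this property. *)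

definition cadjoint :: "('a::complex_inner \<Rightarrow> 'a) \<Rightarrow> 'a \<Rightarrow> 'a" where
  "cadjoint A = (SOME B. \<forall>x y. cinner (A x) y = cinner x (B y))"

definition real_part :: "('a::complex_inner \<Rightarrow> 'a) \<Rightarrow> 'a \<Rightarrow> 'a" where
  "real_part A = (\<lambda>x. (1 / 2) *\<^sub>C (A x + cadjoint A x))"

definition imag_part :: "('a::complex_inner \<Rightarrow> 'a) \<Rightarrow> 'a \<Rightarrow> 'a" where
  "imag_part A = (\<lambda>x. (1 / (2 * \<i>)) *\<^sub>C (A x - cadjoint A x))"

definition numerical_range :: "('a::complex_inner \<Rightarrow> 'a) \<Rightarrow> complex set" where
  "numerical_range A = {cinner (A x) x | x. norm x = 1}"

(* The element 0 matters only for the zero space, which has no unit vector: it makes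
   the supremum there 0, whereas Sup {} is an unspecified real number. *)

definition numerical_radius :: "('a::complex_inner \<Rightarrow> 'a) \<Rightarrow> real" where
  "numerical_radius A = Sup (insert 0 {cmod (cinner (A x) x) | x. norm x = 1})"

definition weighted_numerical_radius :: "real \<Rightarrow> ('a::complex_inner \<Rightarrow> 'a) \<Rightarrow> real" where
  "weighted_numerical_radius t A = numerical_radius (\<lambda>x. (1 - 2 * t) *\<^sub>R cadjoint A x + A x)"

definition sector :: "real \<Rightarrow> complex set" where
  "sector \<theta> = {z. Re z > 0 \<and> \<bar>Im z\<bar> \<le> tan \<theta> * Re z}"

end

theory Submission
  imports Defs
begin

text \<open>
  Put \<open>p = \<parallel>a R + b J\<parallel>\<close> and \<open>q = \<parallel>a R - b J\<parallel>\<close>, where \<open>R\<close> and \<open>J\<close> are the real and imaginary parts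
  of \<open>A\<close>, \<open>a\<^sup>2 = (1 - t)\<^sup>3\<close> and \<open>b\<^sup>2 = t\<^sup>3\<close>. As \<open>(1 - 2t) A* + A = 2(1 - t) R + 2t i J\<close>, the
  Cauchy-Schwarz inequality in the plane and the fact that the norm of a self-adjoint operator is
  its numerical radius give \<open>2 max p q \<le> \<omega>\<^sub>t(A)\<close>; moreover
  \<open>2 max p q = p + q + \<bar>p - q\<bar> \<ge> 2 a \<parallel>R\<parallel> + \<bar>p - q\<bar>\<close>. It remains to see \<open>cos \<theta> \<parallel>A\<parallel> \<le> \<parallel>R\<parallel>\<close>. With
  \<open>k = tan \<theta>\<close> the forms \<open>k R - J\<close> and \<open>k R + J\<close> are positive semidefinite, and \<open>A\<close> is the
  combination of them with coefficients \<open>(1 / k \<mp> i) / 2\<close>; applying the Cauchy-Schwarz inequality to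
  each of them bounds \<open>\<bar>\<langle>A x, y\<rangle>\<bar>\<^sup>2\<close> by \<open>(1 + k\<^sup>2) \<langle>R x, x\<rangle> \<langle>R y, y\<rangle>\<close>. The case
  \<open>k = 0\<close> is reached by letting \<open>k\<close> decrease to \<open>0\<close>.
\<close>

section \<open>Complex inner product spaces\<close>

lemma cinner_add_right: "cinner x (y + z) = cinner x y + cinner x (z :: 'a::complex_inner)"
  by (metis cinner_add_left cinner_commute complex_cnj_add)

lemma cinner_scaleC_right: "cinner x (c *\<^sub>C y) = cnj c * cinner x (y :: 'a::complex_inner)"
  by (metis cinner_commute cinner_scaleC_left complex_cnj_mult)

lemma cinner_scaleR_left: "cinner (r *\<^sub>R x) y = of_real r * cinner x (y :: 'a::complex_inner)"
  by (simp add: scaleR_eq_scaleC cinner_scaleC_left)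

lemma cinner_scaleR_right: "cinner x (r *\<^sub>R y) = of_real r * cinner x (y :: 'a::complex_inner)"
  by (simp add: scaleR_eq_scaleC cinner_scaleC_right)

lemma cinner_minus_left: "cinner (- x) y = - cinner x (y :: 'a::complex_inner)"
  using cinner_scaleR_left[of "-1" x y] by simp

lemma cinner_minus_right: "cinner x (- y) = - cinner x (y :: 'a::complex_inner)"
  using cinner_scaleR_right[of x "-1" y] by simp

lemma cinner_diff_left: "cinner (x - y) z = cinner x z - cinner y (z :: 'a::complex_inner)"
  using cinner_add_left[of x "- y" z] by (simp add: cinner_minus_left)

lemma cinner_diff_right: "cinner x (y - z) = cinner x y - cinner x (z :: 'a::complex_inner)"
  using cinner_add_right[of x y "- z"] by (simp add: cinner_minus_right)

lemmas cinner_linear =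
  cinner_add_left cinner_add_right cinner_diff_left cinner_diff_right
  cinner_scaleC_left cinner_scaleC_right cinner_scaleR_left cinner_scaleR_right

lemma Re_cinner_self: "Re (cinner x x) = (norm (x :: 'a::complex_inner))\<^sup>2"
  by (simp add: norm_eq_sqrt_cinner cinner_ge_zero)

lemma cinner_self: "cinner x x = of_real ((norm (x :: 'a::complex_inner))\<^sup>2)"
  by (metis Re_cinner_self cinner_commute complex_is_Real_iff Reals_cnj_iff of_real_Re)

lemma cinner_left_cancel:
  assumes "\<And>x. cinner x u = cinner x (v :: 'a::complex_inner)"
  shows "u = v"
  using cinner_eq_zero_iff[of "u - v"] assms by (simp add: cinner_diff_right)

lemma Re_cinner_commute: "Re (cinner x y) = Re (cinner y (x :: 'a::complex_inner))"
  by (metis cinner_commute complex_cnj(1) cnj.simps(1))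

lemma norm_add_squared:
  "(norm (x + y :: 'a::complex_inner))\<^sup>2 = (norm x)\<^sup>2 + 2 * Re (cinner x y) + (norm y)\<^sup>2"
  using Re_cinner_commute[of y x]
  by (simp flip: Re_cinner_self add: cinner_linear)

lemma parallelogram:
  "(norm (x + y :: 'a::complex_inner))\<^sup>2 + (norm (x - y))\<^sup>2 = 2 * (norm x)\<^sup>2 + 2 * (norm y)\<^sup>2"
  by (simp flip: Re_cinner_self add: cinner_linear)

lemma norm_scaleC: "norm (c *\<^sub>C (x :: 'a::complex_inner)) = cmod c * norm x"
proof -
  have "cinner (c *\<^sub>C x) (c *\<^sub>C x) = (c * cnj c) * cinner x x"
    by (simp add: cinner_linear)
  also have "\<dots> = of_real ((cmod c * norm x)\<^sup>2)"
    by (simp only: cinner_self complex_norm_square[symmetric] power_mult_distrib of_real_mult)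
  finally have "Re (cinner (c *\<^sub>C x) (c *\<^sub>C x)) = (cmod c * norm x)\<^sup>2"
    by (simp only: Re_complex_of_real)
  then show ?thesis
    by (simp add: norm_eq_sqrt_cinner[of "c *\<^sub>C x"])
qed

section \<open>Cauchy-Schwarz for positive semidefinite forms\<close>

lemma quadratic_nonneg_imp:
  fixes a b c :: real
  assumes "\<And>s. 0 \<le> a + 2 * s * c + s\<^sup>2 * b"
    and b: "0 \<le> b"
  shows "c\<^sup>2 \<le> a * b"
proof (cases "b = 0")
  case True
  have "c = 0"
  proof (rule ccontr)
    assume "c \<noteq> 0"
    \<comment> \<open>With \<open>b = 0\<close> the polynomial is affine in \<open>s\<close>, and
      this choice gives it the value \<open>-1\<close>.\<close>
    with assms(1)[of "- (a + 1) / (2 * c)"] True show False by (simp add: field_simps)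
  qed
  with True show ?thesis by simp
next
  case False
  with b have "0 < b" by simp
  \<comment> \<open>\<open>- c / b\<close> is the minimiser of the quadratic.\<close>
  with assms(1)[of "- c / b"] have "0 \<le> a - c\<^sup>2 / b"
    by (simp add: power2_eq_square field_simps)
  with \<open>0 < b\<close> show ?thesis by (simp add: field_simps)
qed

text \<open>Rotating one argument of a sesquilinear form by such a \<open>u\<close> makes its value
  real and nonnegative, so that a discriminant argument with real parameter captures the full
  modulus.\<close>

lemma exists_phase:
  obtains u where "cmod u = 1" "u * z = of_real (cmod z)"
proof (cases "z = 0")
  case True
  with that[of 1] show ?thesis by simp
next
  case False
  show ?thesis
  proof (rule that[of "cnj z / of_real (cmod z)"])
    show "cmod (cnj z / of_real (cmod z)) = 1"
      using False by (simp add: norm_divide)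
    show "cnj z / of_real (cmod z) * z = of_real (cmod z)"
      using False by (simp add: field_simps flip: complex_norm_square power2_eq_square of_real_mult)
  qed
qed

text \<open>Semidefinite forms are treated in general because Cauchy-Schwarz is applied both to the
  inner product and to the forms of \<open>k R - J\<close> and \<open>k R + J\<close>, which may
  vanish on nonzero vectors.\<close>

locale psd_form =
  fixes h :: "'a::complex_inner \<Rightarrow> 'a \<Rightarrow> complex"
  assumes add_left: "h (x + y) z = h x z + h y z"
    and scaleC_left: "h (c *\<^sub>C x) y = c * h x y"
    and hermitian: "h x y = cnj (h y x)"
    and nonneg: "0 \<le> Re (h x x)"
begin

lemma add_right: "h x (y + z) = h x y + h x z"
  by (metis add_left hermitian complex_cnj_add)

lemma scaleC_right: "h x (c *\<^sub>C y) = cnj c * h x y"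
  by (metis scaleC_left hermitian complex_cnj_mult)

text \<open>With the phase \<open>u\<close> absorbed into \<open>x\<close>, the form at
  \<open>u x + s y\<close> is a nonnegative quadratic in the real variable \<open>s\<close> whose
  linear coefficient is twice \<open>cmod (h x y)\<close>; its discriminant gives the bound.\<close>

lemma Cauchy_Schwarz: "(cmod (h x y))\<^sup>2 \<le> Re (h x x) * Re (h y y)"
proof -
  obtain u where u: "cmod u = 1" "u * h x y = of_real (cmod (h x y))"
    by (rule exists_phase)
  have uu: "u * (cnj u * z) = z" for z
    using u(1) by (simp flip: mult.assoc complex_norm_square)
  have yx: "cnj u * h y x = of_real (cmod (h x y))"
    using arg_cong[OF u(2), of cnj] hermitian[of y x] by simp
  show ?thesis
  proof (rule quadratic_nonneg_imp)
    fix s :: real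
    have "h (u *\<^sub>C x + of_real s *\<^sub>C y) (u *\<^sub>C x + of_real s *\<^sub>C y)
        = h x x + of_real s * (u * h x y) + of_real s * (cnj u * h y x) + of_real s * of_real s * h y y"
      by (simp add: add_left add_right scaleC_left scaleC_right algebra_simps uu)
    also have "\<dots> = h x x + of_real (2 * s * cmod (h x y)) + of_real (s\<^sup>2) * h y y"
      by (simp add: u(2) yx power2_eq_square algebra_simps)
    finally show "0 \<le> Re (h x x) + 2 * s * cmod (h x y) + s\<^sup>2 * Re (h y y)"
      using nonneg[of "u *\<^sub>C x + of_real s *\<^sub>C y"] by simp
  qed (rule nonneg)
qed

lemma Cauchy_Schwarz_sqrt: "cmod (h x y) \<le> sqrt (Re (h x x)) * sqrt (Re (h y y))"
  using Cauchy_Schwarz[of x y] by (simp add: real_le_rsqrt flip: real_sqrt_mult)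

end

lemma cmod_cinner_le: "cmod (cinner x y) \<le> norm x * norm (y :: 'a::complex_inner)"
proof -
  interpret psd_form "cinner :: 'a \<Rightarrow> 'a \<Rightarrow> complex"
    by unfold_locales (auto simp: cinner_linear cinner_ge_zero intro: cinner_commute)
  show ?thesis
    using Cauchy_Schwarz_sqrt[of x y] by (simp add: norm_eq_sqrt_cinner)
qed

section \<open>The adjoint\<close>

text \<open>The representing vector minimises \<open>\<parallel>x\<parallel>\<^sup>2 - 2 Re (f x)\<close>; minimising sequences converge by the
  parallelogram law.\<close>

lemma Riesz_representation:
  fixes f :: "'a::chilbert_space \<Rightarrow> complex"
  assumes f: "bounded_linear f" and f_scaleC: "\<And>c x. f (c *\<^sub>C x) = c * f x"
  obtains v where "\<And>x. f x = cinner x v"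
proof -
  define \<Phi> where "\<Phi> x = (norm x)\<^sup>2 - 2 * Re (f x)" for x
  obtain K where K: "\<And>x. norm (f x) \<le> norm x * K"
    using f bounded_linear.bounded by blast
  interpret f: bounded_linear f by (rule f)
  \<comment> \<open>Completing the square in \<open>norm x\<close> bounds \<Phi> below, so its
    infimum is finite.\<close>
  have low: "- (K\<^sup>2) \<le> \<Phi> x" for x
  proof -
    have "Re (f x) \<le> norm x * K"
      using K[of x] complex_Re_le_cmod[of "f x"] by linarith
    moreover have "0 \<le> (norm x - K)\<^sup>2" by simp
    ultimately show ?thesis unfolding \<Phi>_def power2_diff by linarith
  qed
  define m where "m = Inf (range \<Phi>)"
  have bdd: "bdd_below (range \<Phi>)" using low by (auto simp: bdd_below_def)
  have m: "m \<le> \<Phi> x" for x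
    unfolding m_def using bdd by (simp add: cInf_lower)
  \<comment> \<open>By the parallelogram law the squared distance equals
    \<open>2 * \<Phi> x + 2 * \<Phi> y\<close> minus four times the value of \<Phi> at the midpoint,
    and that value is at least \<open>m\<close>.\<close>
  have mid: "(norm (x - y))\<^sup>2 \<le> 2 * (\<Phi> x - m) + 2 * (\<Phi> y - m)" for x y
  proof -
    have "(norm ((1/2) *\<^sub>R (x + y)))\<^sup>2 = (norm (x + y))\<^sup>2 / 4"
      by (simp only: norm_scaleR power_mult_distrib) (simp add: power2_eq_square)
    then have "4 * \<Phi> ((1/2) *\<^sub>R (x + y)) = (norm (x + y))\<^sup>2 - 4 * (Re (f x) + Re (f y))"
      by (simp only: \<Phi>_def f.scaleR f.add) (simp add: add_divide_distrib)
    with m[of "(1/2) *\<^sub>R (x + y)"] parallelogram[of x y] show ?thesis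
      unfolding \<Phi>_def by argo
  qed
  have "\<exists>x. \<Phi> x < m + inverse (real (Suc n))" for n
    using cInf_lessD[of "range \<Phi>" "m + inverse (real (Suc n))"] by (auto simp: m_def)
  then obtain X where X: "\<And>n. \<Phi> (X n) < m + inverse (real (Suc n))" by metis
  have "Cauchy X"
  proof (rule metric_CauchyI)
    fix e :: real assume "0 < e"
    \<comment> \<open>Two excesses over \<open>m\<close> below a quarter of the squared
      \<open>e\<close>, each doubled in \<open>mid\<close>, add up to less than the squared
      \<open>e\<close>.\<close>
    then obtain N where N: "inverse (real (Suc N)) < e\<^sup>2 / 4"
      using reals_Archimedean[of "e\<^sup>2 / 4"] by auto
    have small: "\<Phi> (X n) - m < e\<^sup>2 / 4" if "n \<ge> N" for n
    proof -
      have "inverse (real (Suc n)) \<le> inverse (real (Suc N))"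
        using that by (simp add: le_imp_inverse_le)
      with X[of n] N show ?thesis by linarith
    qed
    show "\<exists>M. \<forall>i\<ge>M. \<forall>j\<ge>M. dist (X i) (X j) < e"
    proof (intro exI allI impI)
      fix i j assume "i \<ge> N" "j \<ge> N"
      then have "(norm (X i - X j))\<^sup>2 < e\<^sup>2"
        using mid[of "X i" "X j"] small[of i] small[of j] by argo
      then show "dist (X i) (X j) < e"
        using \<open>0 < e\<close> by (simp add: dist_norm power2_less_imp_less)
    qed
  qed
  then obtain v where v: "X \<longlonglongrightarrow> v"
    using Cauchy_convergent convergent_def by blast
  have "(\<lambda>n. \<Phi> (X n)) \<longlonglongrightarrow> \<Phi> v"
    unfolding \<Phi>_def by (intro tendsto_intros f.tendsto v)
  moreover have "(\<lambda>n. m + inverse (real (Suc n))) \<longlonglongrightarrow> m + 0"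
    by (intro tendsto_intros LIMSEQ_inverse_real_of_nat)
  ultimately have "\<Phi> v \<le> m + 0"
    using X by (intro LIMSEQ_le) (auto intro: less_imp_le)
  then have vmin: "\<Phi> v \<le> \<Phi> x" for x using m[of x] by simp
  \<comment> \<open>First variation at the minimiser: the increment of \<Phi> along
    \<open>s x\<close> is a nonnegative quadratic in \<open>s\<close> with constant term 0, so its
    linear coefficient vanishes.\<close>
  have Re_eq: "Re (f x) = Re (cinner x v)" for x
  proof -
    have "(Re (cinner v x) - Re (f x))\<^sup>2 \<le> 0 * (norm x)\<^sup>2"
    proof (rule quadratic_nonneg_imp)
      fix s :: real
      have "\<Phi> (v + s *\<^sub>R x) = \<Phi> v + 2 * s * (Re (cinner v x) - Re (f x)) + s\<^sup>2 * (norm x)\<^sup>2"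
        unfolding \<Phi>_def norm_add_squared
        by (simp add: cinner_linear f.add f.scaleR power_mult_distrib algebra_simps)
      with vmin[of "v + s *\<^sub>R x"]
      show "0 \<le> 0 + 2 * s * (Re (cinner v x) - Re (f x)) + s\<^sup>2 * (norm x)\<^sup>2" by linarith
    qed simp
    then show ?thesis using Re_cinner_commute[of x v] by simp
  qed
  \<comment> \<open>Testing the real parts at \<open>\<i> *\<^sub>C x\<close> recovers the imaginary
    parts.\<close>
  have "f x = cinner x v" for x
    using Re_eq[of x] Re_eq[of "\<i> *\<^sub>C x"]
    by (simp add: complex_eq_iff f_scaleC cinner_linear)
  then show ?thesis by (rule that)
qed

text \<open>Riesz representation of the functional sending \<open>x\<close> to
  \<open>cinner (A x) y\<close>, for each \<open>y\<close>, supplies a witness for the choice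
  operator in \<open>cadjoint\<close>.\<close>

lemma cadjoint_cinner:
  fixes A :: "'a::chilbert_space \<Rightarrow> 'a"
  assumes "bounded_clinear A"
  shows "cinner (A x) y = cinner x (cadjoint A y)"
proof -
  interpret A: bounded_linear A using assms by (simp add: bounded_clinear_def)
  obtain K where K: "\<And>x. norm (A x) \<le> norm x * K" using A.bounded by blast
  have "\<exists>v. \<forall>x. cinner (A x) y = cinner x v" for y
  proof -
    have "bounded_linear (\<lambda>x. cinner (A x) y)"
    proof (rule bounded_linear_intro)
      show "norm (cinner (A x) y) \<le> norm x * (K * norm y)" for x
        using order_trans[OF cmod_cinner_le mult_right_mono[OF K]] by (simp add: mult.assoc)
    qed (auto simp: A.add A.scaleR cinner_linear scaleR_conv_of_real)
    then show ?thesis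
      using Riesz_representation[of "\<lambda>x. cinner (A x) y"] assms
      by (metis bounded_clinear_def cinner_scaleC_left)
  qed
  then have "\<exists>B. \<forall>x y. cinner (A x) y = cinner x (B y)" by metis
  then show ?thesis unfolding cadjoint_def by (rule someI2_ex) blast
qed

lemma bounded_linear_scaleC: "bounded_linear (\<lambda>x :: 'a::complex_inner. c *\<^sub>C x)"
  by (rule bounded_linear_intro[of _ "cmod c"])
    (auto simp: scaleC_add_right scaleR_eq_scaleC scaleC_scaleC norm_scaleC mult.commute)

lemma bounded_linear_cadjoint:
  fixes A :: "'a::chilbert_space \<Rightarrow> 'a"
  assumes A: "bounded_clinear A"
  shows "bounded_linear (cadjoint A)"
proof -
  note adj = cadjoint_cinner[OF A, symmetric]
  obtain K where K: "\<And>x. norm (A x) \<le> norm x * K"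
    using A bounded_linear.bounded[of A] unfolding bounded_clinear_def by blast
  show ?thesis
  proof (rule bounded_linear_intro)
    show "cadjoint A (x + y) = cadjoint A x + cadjoint A y" for x y
      by (rule cinner_left_cancel) (simp add: adj cinner_linear)
    show "cadjoint A (r *\<^sub>R x) = r *\<^sub>R cadjoint A x" for r x
      by (rule cinner_left_cancel) (simp add: adj cinner_linear)
    show "norm (cadjoint A x) \<le> norm x * K" for x
    \<comment> \<open>The nonzero case tests the adjoint relation on \<open>cadjoint A x\<close>
      itself and cancels one factor of its norm. \<open>K\<close> carries no sign assumption, so the
      zero case needs its own argument.\<close>
    proof (cases "cadjoint A x = 0")
      case True
      have "0 \<le> norm x * K" using K[of x] norm_ge_zero[of "A x"] by linarith
      with True show ?thesis by simp
    next
      case False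
      have "norm (cadjoint A x) * norm (cadjoint A x) = cmod (cinner (cadjoint A x) (cadjoint A x))"
        by (simp add: cinner_self power2_eq_square norm_mult)
      also have "cinner (cadjoint A x) (cadjoint A x) = cinner (A (cadjoint A x)) x" by (rule adj)
      also have "cmod (cinner (A (cadjoint A x)) x) \<le> norm (A (cadjoint A x)) * norm x" by (rule cmod_cinner_le)
      also have "\<dots> \<le> norm (cadjoint A x) * K * norm x" by (rule mult_right_mono[OF K]) simp
      finally have "norm (cadjoint A x) * norm (cadjoint A x) \<le> norm (cadjoint A x) * (norm x * K)"
        by (simp add: ac_simps)
      with False show ?thesis by simp
    qed
  qed
qed

section \<open>Real and imaginary parts as self-adjoint operators\<close>

context
  fixes A :: "'a::chilbert_space \<Rightarrow> 'a"
  assumes A: "bounded_clinear A"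
begin

lemma cinner_cadjoint_left: "cinner (cadjoint A x) y = cinner x (A y)"
  using cadjoint_cinner[OF A, of y x] cinner_commute by metis

lemma bounded_linear_real_part: "bounded_linear (real_part A)"
  unfolding real_part_def
  by (intro bounded_linear_compose[OF bounded_linear_scaleC] bounded_linear_add
      bounded_linear_cadjoint A) (use A in \<open>simp add: bounded_clinear_def\<close>)

lemma bounded_linear_imag_part: "bounded_linear (imag_part A)"
  unfolding imag_part_def
  by (intro bounded_linear_compose[OF bounded_linear_scaleC] bounded_linear_sub
      bounded_linear_cadjoint A) (use A in \<open>simp add: bounded_clinear_def\<close>)

lemma real_part_selfadjoint: "cinner (real_part A x) y = cinner x (real_part A y)"
  by (simp add: real_part_def cinner_linear cinner_cadjoint_left cadjoint_cinner[OF A])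

lemma imag_part_selfadjoint: "cinner (imag_part A x) y = cinner x (imag_part A y)"
  by (simp add: imag_part_def cinner_linear cinner_cadjoint_left cadjoint_cinner[OF A] field_simps)

lemma cinner_cadjoint_self: "cinner (cadjoint A x) x = cnj (cinner (A x) x)"
  by (simp add: cinner_cadjoint_left flip: cinner_commute)

lemma cinner_real_part_self: "cinner (real_part A x) x = of_real (Re (cinner (A x) x))"
  by (simp add: real_part_def cinner_linear cinner_cadjoint_self complex_add_cnj)

lemma cinner_imag_part_self: "cinner (imag_part A x) x = of_real (Im (cinner (A x) x))"
  by (simp add: imag_part_def cinner_linear cinner_cadjoint_self complex_eq_iff)

end

section \<open>Norm bounds from quadratic forms\<close>

lemma quadratic_form_bound:
  fixes T :: "'a::complex_inner \<Rightarrow> 'a"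
  assumes T: "bounded_linear T"
    and unit: "\<And>x. norm x = 1 \<Longrightarrow> cmod (cinner (T x) x) \<le> M"
  shows "cmod (cinner (T x) x) \<le> M * (norm x)\<^sup>2"
proof (cases "x = 0")
  case True
  then show ?thesis by (simp add: cinner_linear cinner_self linear_0[OF bounded_linear.linear[OF T]])
next
  case False
  interpret bounded_linear T by (rule T)
  have "cinner (T (x /\<^sub>R norm x)) (x /\<^sub>R norm x) = cinner (T x) x / of_real ((norm x)\<^sup>2)"
    by (simp add: scaleR cinner_linear power2_eq_square divide_inverse)
  moreover have "cmod (cinner (T (x /\<^sub>R norm x)) (x /\<^sub>R norm x)) \<le> M"
    using False by (intro unit) simp
  ultimately show ?thesis
    using False by (simp add: norm_divide norm_power pos_divide_le_eq)
qed

text \<open>Polarisation: the difference of the quadratic form at \<open>x + y\<close> and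
  \<open>x - y\<close> is four times the real part of \<open>cinner (S x) y\<close>, and the
  parallelogram law bounds it. \<open>M\<close> has a separate sign assumption because the zero
  space has no unit vectors.\<close>

lemma onorm_selfadjoint_le:
  fixes S :: "'a::complex_inner \<Rightarrow> 'a"
  assumes S: "bounded_linear S"
    and sa: "\<And>x y. cinner (S x) y = cinner x (S y)"
    and unit: "\<And>x. norm x = 1 \<Longrightarrow> cmod (cinner (S x) x) \<le> M"
    and M: "0 \<le> M"
  shows "onorm S \<le> M"
proof (rule onorm_bound[OF M])
  fix x
  interpret bounded_linear S by (rule S)
  note q = quadratic_form_bound[OF S unit]
  show "norm (S x) \<le> M * norm x"
  proof (cases "S x = 0 \<or> x = 0")
    case True
    with M show ?thesis by (auto simp: zero)
  next
    case False
    \<comment> \<open>This scaling gives \<open>y\<close> the direction of \<open>S x\<close> and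
      the length of \<open>x\<close>, so the inner product with \<open>S x\<close> is as large as
      Cauchy-Schwarz permits.\<close>
    define l where "l = norm x / norm (S x)"
    define y where "y = l *\<^sub>R S x"
    have ny: "norm y = norm x" using False by (simp add: y_def l_def)
    have Sxy: "cinner (S x) y = of_real (norm x * norm (S x))"
      using False by (simp add: y_def l_def cinner_linear cinner_self power2_eq_square)
    have "cinner (S (x + y)) (x + y) - cinner (S (x - y)) (x - y)
        = 2 * cinner (S x) y + 2 * cinner (S y) x"
      by (simp add: add diff cinner_linear)
    moreover have "Re (cinner (S y) x) = Re (cinner (S x) y)"
      using sa[of y x] Re_cinner_commute[of y "S x"] by simp
    ultimately have "4 * Re (cinner (S x) y)
        = Re (cinner (S (x + y)) (x + y)) - Re (cinner (S (x - y)) (x - y))"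
      by (simp add: complex_eq_iff)
    also have "\<dots> \<le> M * (norm (x + y))\<^sup>2 + M * (norm (x - y))\<^sup>2"
      using q[of "x + y"] q[of "x - y"] abs_Re_le_cmod[of "cinner (S (x + y)) (x + y)"]
        abs_Re_le_cmod[of "cinner (S (x - y)) (x - y)"] by linarith
    also have "\<dots> = M * (4 * (norm x)\<^sup>2)"
      by (simp flip: distrib_left add: parallelogram ny)
    finally have "norm x * norm (S x) \<le> norm x * (M * norm x)"
      by (simp add: Sxy power2_eq_square mult.left_commute)
    with False show ?thesis by simp
  qed
qed

text \<open>For \<open>k = tan \<theta>\<close> the factor \<open>sqrt (1 + k\<^sup>2)\<close> is
  \<open>1 / cos \<theta>\<close>. Positivity of \<open>k\<close> allows \<open>A\<close> to be
  recovered from the two semidefinite forms.\<close>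

lemma onorm_le_sectorial_pos:
  fixes A :: "'a::complex_inner \<Rightarrow> 'a"
  assumes A: "bounded_clinear A" and k: "0 < k" and M: "0 \<le> M"
    and sect: "\<And>x. \<bar>Im (cinner (A x) x)\<bar> \<le> k * Re (cinner (A x) x)"
    and Re_le: "\<And>x. Re (cinner (A x) x) \<le> M * (norm x)\<^sup>2"
  shows "onorm A \<le> sqrt (1 + k\<^sup>2) * M"
proof -
  interpret bounded_linear A using A by (simp add: bounded_clinear_def)
  have A_scaleC: "A (c *\<^sub>C x) = c *\<^sub>C A x" for c x using A by (simp add: bounded_clinear_def)
  define g where "g x y = cinner (A x) y" for x y
  define r where "r x = Re (g x x)" for x
  \<comment> \<open>The form of \<open>k R + \<epsilon> J\<close>, with \<open>R\<close> and
    \<open>J\<close> read off from \<open>g\<close> and its conjugate transpose, so that no adjoint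
    operator appears.\<close>
  define h where "h \<epsilon> x y = of_real k * ((g x y + cnj (g y x)) / 2)
      + of_real \<epsilon> * ((g x y - cnj (g y x)) / (2 * \<i>))" for \<epsilon> x y
  have h_self: "Re (h \<epsilon> x x) = k * r x + \<epsilon> * Im (g x x)" for \<epsilon> x
    by (simp add: h_def r_def complex_add_cnj complex_diff_cnj)
  have r0: "0 \<le> r x" for x
    using sect[of x] k by (smt (verit) g_def r_def mult_less_0_iff)
  have psd: "psd_form (h \<epsilon>)" if "\<bar>\<epsilon>\<bar> = 1" for \<epsilon>
  proof
    fix x y z :: 'a and c :: complex
    show "h \<epsilon> (x + y) z = h \<epsilon> x z + h \<epsilon> y z"
      by (simp add: h_def g_def add cinner_linear field_simps)
    show "h \<epsilon> (c *\<^sub>C x) y = c * h \<epsilon> x y"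
      by (simp add: h_def g_def A_scaleC cinner_linear field_simps)
    show "h \<epsilon> x y = cnj (h \<epsilon> y x)"
      by (simp add: h_def field_simps)
    have "\<bar>\<epsilon> * Im (g x x)\<bar> \<le> k * r x"
      using sect[of x] that by (simp add: abs_mult g_def r_def)
    then show "0 \<le> Re (h \<epsilon> x x)" unfolding h_self by linarith
  qed
  have sesq: "cmod (g x y) \<le> sqrt (1 + k\<^sup>2) * (sqrt (r x) * sqrt (r y))" for x y
  proof -
    define p q where "p = h (-1)" and "q = h 1"
    interpret p: psd_form p unfolding p_def by (rule psd) simp
    interpret q: psd_form q unfolding q_def by (rule psd) simp
    have sum_self: "Re (p x x) + Re (q x x) = 2 * k * r x" for x
      by (simp add: p_def q_def h_self)
    \<comment> \<open>From \<open>p = k R - J\<close> and \<open>q = k R + J\<close> follow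
      \<open>2 k R = p + q\<close> and \<open>2 J = q - p\<close>; both coefficients have the same
      modulus.\<close>
    have g_eq: "of_real (2 * k) * g x y = Complex 1 (- k) * p x y + Complex 1 k * q x y"
      unfolding p_def q_def h_def by (simp add: Complex_eq field_simps)
    have cm: "cmod (Complex 1 (- k)) = sqrt (1 + k\<^sup>2)" "cmod (Complex 1 k) = sqrt (1 + k\<^sup>2)"
      by (simp_all add: cmod_def)
    have "2 * k * cmod (g x y) = cmod (of_real (2 * k) * g x y)"
      using k by (simp add: norm_mult)
    also have "\<dots> \<le> sqrt (1 + k\<^sup>2) * cmod (p x y) + sqrt (1 + k\<^sup>2) * cmod (q x y)"
      unfolding g_eq using norm_triangle_ineq[of "Complex 1 (- k) * p x y" "Complex 1 k * q x y"]
      by (simp add: norm_mult cm)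
    also have "\<dots> = sqrt (1 + k\<^sup>2) * (cmod (p x y) + cmod (q x y))"
      by (simp add: distrib_left)
    also have "\<dots> \<le> sqrt (1 + k\<^sup>2) * (2 * k * (sqrt (r x) * sqrt (r y)))"
    proof (rule mult_left_mono)
      have "cmod (p x y) + cmod (q x y)
          \<le> sqrt (Re (p x x)) * sqrt (Re (p y y)) + sqrt (Re (q x x)) * sqrt (Re (q y y))"
        by (intro add_mono p.Cauchy_Schwarz_sqrt q.Cauchy_Schwarz_sqrt)
      \<comment> \<open>Cauchy-Schwarz in the plane groups the diagonal values of \<open>p\<close>
        and \<open>q\<close> at the same vector, where the contributions of \<open>J\<close>
        cancel.\<close>
      also have "\<dots> \<le> sqrt ((sqrt (Re (p x x)))\<^sup>2 + (sqrt (Re (q x x)))\<^sup>2)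
          * sqrt ((sqrt (Re (p y y)))\<^sup>2 + (sqrt (Re (q y y)))\<^sup>2)"
        using norm_cauchy_schwarz[of "(sqrt (Re (p x x)), sqrt (Re (q x x)))" "(sqrt (Re (p y y)), sqrt (Re (q y y)))"]
        by (simp only: inner_Pair norm_Pair inner_real_def real_norm_def power2_abs)
      also have "\<dots> = sqrt (2 * k * r x) * sqrt (2 * k * r y)"
        using p.nonneg q.nonneg by (simp add: sum_self)
      also have "\<dots> = 2 * k * (sqrt (r x) * sqrt (r y))"
      proof -
        have "sqrt (2 * k) * sqrt (2 * k) = 2 * k" using k by simp
        then show ?thesis unfolding real_sqrt_mult[of "2 * k"] by algebra
      qed
      finally show "cmod (p x y) + cmod (q x y) \<le> 2 * k * (sqrt (r x) * sqrt (r y))" .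
    qed simp
    finally have "(2 * k) * cmod (g x y) \<le> (2 * k) * (sqrt (1 + k\<^sup>2) * (sqrt (r x) * sqrt (r y)))"
      by (simp add: ac_simps)
    with k show ?thesis by simp
  qed
  have sqrt_r: "sqrt (r x) \<le> sqrt M * norm x" for x
    using Re_le[of x] by (metis g_def r_def norm_ge_zero real_sqrt_le_mono real_sqrt_mult
        real_sqrt_unique)
  show ?thesis
  proof (rule onorm_bound)
    fix x
    \<comment> \<open>The sesquilinear bound at \<open>y = A x\<close>; a factor
      \<open>norm (A x)\<close> is cancelled at the end.\<close>
    have "norm (A x) * norm (A x) = cmod (g x (A x))"
      by (simp add: g_def cinner_self power2_eq_square norm_mult)
    also have "\<dots> \<le> sqrt (1 + k\<^sup>2) * (sqrt (r x) * sqrt (r (A x)))" by (rule sesq)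
    also have "\<dots> \<le> sqrt (1 + k\<^sup>2) * ((sqrt M * norm x) * (sqrt M * norm (A x)))"
      using r0 M by (intro mult_left_mono mult_mono sqrt_r) auto
    also have "\<dots> = (sqrt (1 + k\<^sup>2) * (sqrt M * sqrt M) * norm x) * norm (A x)"
      by (simp only: ac_simps)
    also have "sqrt M * sqrt M = M" using M by simp
    finally show "norm (A x) \<le> sqrt (1 + k\<^sup>2) * M * norm x"
      using M by (cases "A x = 0") auto
  qed (use M in simp)
qed

text \<open>Replacing \<open>k\<close> by \<open>k + e\<close> keeps the sector condition because
  the real part is nonnegative, which has to be assumed: for \<open>k = 0\<close> the sector
  condition only makes the form real.\<close>

lemma onorm_le_sectorial:
  fixes A :: "'a::complex_inner \<Rightarrow> 'a"
  assumes A: "bounded_clinear A" and k: "0 \<le> k" and M: "0 \<le> M"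
    and sect: "\<And>x. \<bar>Im (cinner (A x) x)\<bar> \<le> k * Re (cinner (A x) x)"
    and Re_ge: "\<And>x. 0 \<le> Re (cinner (A x) x)"
    and Re_le: "\<And>x. Re (cinner (A x) x) \<le> M * (norm x)\<^sup>2"
  shows "onorm A \<le> sqrt (1 + k\<^sup>2) * M"
proof (rule tendsto_lowerbound)
  show "((\<lambda>e. sqrt (1 + (k + e)\<^sup>2) * M) \<longlongrightarrow> sqrt (1 + k\<^sup>2) * M) (at_right 0)"
    by (auto intro!: tendsto_eq_intros)
  show "\<forall>\<^sub>F e in at_right 0. onorm A \<le> sqrt (1 + (k + e)\<^sup>2) * M"
    unfolding eventually_at_right_field
  proof (intro exI[of _ 1] conjI allI impI)
    fix e :: real assume e: "0 < e"
    show "onorm A \<le> sqrt (1 + (k + e)\<^sup>2) * M"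
    proof (rule onorm_le_sectorial_pos[OF A _ M _ Re_le])
      show "0 < k + e" using k e by simp
      fix x
      have "0 \<le> e * Re (cinner (A x) x)" using e Re_ge[of x] by simp
      with sect[of x] show "\<bar>Im (cinner (A x) x)\<bar> \<le> (k + e) * Re (cinner (A x) x)"
        by (simp add: distrib_right)
    qed
  qed simp
qed simp

section \<open>Elementary bounds for the numerical radius\<close>

lemma bdd_above_numerical_radius:
  fixes T :: "'a::complex_inner \<Rightarrow> 'a"
  assumes T: "bounded_linear T"
  shows "bdd_above (insert 0 {cmod (cinner (T x) x) | x. norm x = 1})"
proof -
  have "cmod (cinner (T x) x) \<le> onorm T" if "norm x = 1" for x
    using cmod_cinner_le[of "T x" x] onorm[OF T, of x] that by simp
  then show ?thesis by (auto simp: bdd_above_def intro!: exI[of _ "onorm T"] onorm_pos_le T)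
qed

lemma le_numerical_radius:
  fixes T :: "'a::complex_inner \<Rightarrow> 'a"
  assumes "bounded_linear T" and "norm x = 1"
  shows "cmod (cinner (T x) x) \<le> numerical_radius T"
  unfolding numerical_radius_def
  by (rule cSup_upper) (use assms bdd_above_numerical_radius in auto)

lemma numerical_radius_nonneg:
  fixes T :: "'a::complex_inner \<Rightarrow> 'a"
  assumes "bounded_linear T"
  shows "0 \<le> numerical_radius T"
  unfolding numerical_radius_def
  by (rule cSup_upper) (use assms bdd_above_numerical_radius in auto)

section \<open>The weighted numerical radius\<close>

text \<open>The exponent 3/2 splits as \<open>sqrt (1 - t) * (1 - t)\<close> and
  \<open>sqrt t * t\<close>; the vector \<open>(sqrt (1 - t), sqrt t)\<close> has length 1.\<close>

lemma plane_Cauchy_Schwarz: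
  fixes t r j :: real
  assumes t: "0 \<le> t" "t \<le> 1"
  shows "\<bar>sqrt ((1 - t) ^ 3) * r + sqrt (t ^ 3) * j\<bar> \<le> sqrt (((1 - t) * r)\<^sup>2 + (t * j)\<^sup>2)"
proof -
  have cube: "sqrt (x ^ 3) = sqrt x * x" if "0 \<le> x" for x :: real
    using that by (simp add: power3_eq_cube real_sqrt_mult)
  show ?thesis
    using Cauchy_Schwarz_ineq2[of "(sqrt (1 - t), sqrt t)" "((1 - t) * r, t * j)"] t
    by (simp add: cube norm_Pair mult.assoc)
qed

lemma weighted_numerical_radius_ge:
  fixes A :: "'a::chilbert_space \<Rightarrow> 'a"
  assumes A: "bounded_clinear A" and t: "0 \<le> t" "t \<le> 1"
  shows "2 * sqrt ((1 - t) ^ 3) * onorm (real_part A)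
    + \<bar>onorm (\<lambda>x. sqrt ((1 - t) ^ 3) *\<^sub>R real_part A x + sqrt (t ^ 3) *\<^sub>R imag_part A x)
       - onorm (\<lambda>x. sqrt ((1 - t) ^ 3) *\<^sub>R real_part A x - sqrt (t ^ 3) *\<^sub>R imag_part A x)\<bar>
    \<le> weighted_numerical_radius t A"
proof -
  define a b where "a = sqrt ((1 - t) ^ 3)" and "b = sqrt (t ^ 3)"
  \<comment> \<open>The sign \<open>s\<close> treats the sum and the difference at once: only
    \<open>s = 1\<close> and \<open>s = -1\<close> occur.\<close>
  define P where "P s = (\<lambda>x. a *\<^sub>R real_part A x + s *\<^sub>R (b *\<^sub>R imag_part A x))" for s :: real
  define T where "T = (\<lambda>x. (1 - 2 * t) *\<^sub>R cadjoint A x + A x)"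
  let ?w = "weighted_numerical_radius t A"
  have w: "?w = numerical_radius T" by (simp add: weighted_numerical_radius_def T_def)
  have lin_T: "bounded_linear T"
    unfolding T_def using A
    by (intro bounded_linear_add bounded_linear_scaleR_right[THEN bounded_linear_compose]
        bounded_linear_cadjoint) (auto simp: bounded_clinear_def)
  have lin_P: "bounded_linear (P s)" for s
    unfolding P_def
    by (intro bounded_linear_add bounded_linear_scaleR_right[THEN bounded_linear_compose]
        bounded_linear_real_part bounded_linear_imag_part A)
  have P_le: "onorm (P s) \<le> ?w / 2" if s: "\<bar>s\<bar> = 1" for s
  proof (rule onorm_selfadjoint_le[OF lin_P])
    show "cinner (P s x) y = cinner x (P s y)" for x y
      by (simp add: P_def cinner_linear real_part_selfadjoint[OF A] imag_part_selfadjoint[OF A])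
    show "0 \<le> ?w / 2" using numerical_radius_nonneg[OF lin_T] by (simp add: w)
    fix x :: 'a assume x: "norm x = 1"
    define r j where "r = Re (cinner (A x) x)" and "j = Im (cinner (A x) x)"
    have "cinner (T x) x = 2 * Complex ((1 - t) * r) (t * j)"
      by (simp add: T_def cinner_linear cinner_cadjoint_self[OF A] complex_eq_iff r_def j_def
          algebra_simps)
    also have "cmod \<dots> = 2 * sqrt (((1 - t) * r)\<^sup>2 + (t * j)\<^sup>2)"
      by (simp only: norm_mult) (simp add: cmod_def)
    finally have le_w: "2 * sqrt (((1 - t) * r)\<^sup>2 + (t * j)\<^sup>2) \<le> ?w"
      using le_numerical_radius[OF lin_T x] by (simp add: w)
    have "cinner (P s x) x = of_real (a * r + b * (s * j))"
      by (simp add: P_def cinner_linear cinner_real_part_self[OF A] cinner_imag_part_self[OF A]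
          r_def j_def)
    then have "cmod (cinner (P s x) x) = \<bar>a * r + b * (s * j)\<bar>"
      by (simp only: norm_of_real)
    also have "\<dots> \<le> sqrt (((1 - t) * r)\<^sup>2 + (t * (s * j))\<^sup>2)"
      unfolding a_def b_def by (rule plane_Cauchy_Schwarz[OF t])
    also have "(t * (s * j))\<^sup>2 = (t * j)\<^sup>2"
      using s by (simp add: power_mult_distrib abs_square_eq_1)
    finally show "cmod (cinner (P s x) x) \<le> ?w / 2" using le_w by simp
  qed
  \<comment> \<open>The imaginary parts cancel in \<open>P 1 + P (-1)\<close>. The sum of the two
    norms plus their distance is twice the larger one, hence at most \<open>?w\<close>.\<close>
  have "2 * a * onorm (real_part A) = onorm (\<lambda>x. (2 * a) *\<^sub>R real_part A x)"
    using t by (simp add: onorm_scaleR[OF bounded_linear_real_part[OF A]] a_def)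
  also have "(\<lambda>x. (2 * a) *\<^sub>R real_part A x) = (\<lambda>x. P 1 x + P (-1) x)"
    by (simp add: P_def fun_eq_iff scaleR_2 flip: scaleR_scaleR)
  also have "onorm \<dots> \<le> onorm (P 1) + onorm (P (-1))"
    by (rule onorm_triangle[OF lin_P lin_P])
  finally have "2 * a * onorm (real_part A) + \<bar>onorm (P 1) - onorm (P (-1))\<bar> \<le> ?w"
    using P_le[of 1] P_le[of "-1"] by linarith
  then show ?thesis by (simp add: P_def a_def b_def)
qed

lemma cos_onorm_le_onorm_real_part:
  fixes A :: "'a::chilbert_space \<Rightarrow> 'a"
  assumes \<theta>: "0 \<le> \<theta>" "\<theta> < pi / 2" and A: "bounded_clinear A"
    and W: "numerical_range A \<subseteq> sector \<theta>"
  shows "cos \<theta> * onorm A \<le> onorm (real_part A)"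
proof -
  interpret bounded_linear A using A by (simp add: bounded_clinear_def)
  have cos_pos: "0 < cos \<theta>" using \<theta> by (intro cos_gt_zero_pi) auto
  have tan0: "0 \<le> tan \<theta>" using \<theta> tan_gt_zero[of \<theta>] by (cases "\<theta> = 0") auto
  \<comment> \<open>The numerical range only sees unit vectors; homogeneity extends the sector
    condition to every \<open>x\<close>, with a weak inequality to include
    \<open>x = 0\<close>.\<close>
  have sect: "0 \<le> Re (cinner (A x) x) \<and> \<bar>Im (cinner (A x) x)\<bar> \<le> tan \<theta> * Re (cinner (A x) x)" for x
  proof (cases "x = 0")
    case False
    define y where "y = x /\<^sub>R norm x"
    have "norm y = 1" using False by (simp add: y_def)
    then have "cinner (A y) y \<in> sector \<theta>" using W by (auto simp: numerical_range_def)
    moreover have "cinner (A x) x = of_real ((norm x)\<^sup>2) * cinner (A y) y"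
      using False by (simp add: y_def scaleR cinner_linear power2_eq_square field_simps)
    ultimately show ?thesis
      using False by (simp add: sector_def abs_mult mult.left_commute)
  qed (simp add: zero cinner_self)
  have "onorm A \<le> sqrt (1 + (tan \<theta>)\<^sup>2) * onorm (real_part A)"
  proof (rule onorm_le_sectorial[OF A tan0])
    show "0 \<le> onorm (real_part A)" by (rule onorm_pos_le[OF bounded_linear_real_part[OF A]])
    fix x
    have "Re (cinner (A x) x) = Re (cinner (real_part A x) x)"
      by (simp add: cinner_real_part_self[OF A])
    also have "\<dots> \<le> norm (real_part A x) * norm x"
      using cmod_cinner_le complex_Re_le_cmod order_trans by blast
    also have "\<dots> \<le> onorm (real_part A) * norm x * norm x"
      by (intro mult_right_mono onorm bounded_linear_real_part A) simp
    finally show "Re (cinner (A x) x) \<le> onorm (real_part A) * (norm x)\<^sup>2"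
      by (simp add: power2_eq_square mult.assoc)
  qed (use sect in auto)
  also have "sqrt (1 + (tan \<theta>)\<^sup>2) = 1 / cos \<theta>"
  proof (rule real_sqrt_unique)
    show "(1 / cos \<theta>)\<^sup>2 = 1 + (tan \<theta>)\<^sup>2"
      using tan_sec[of \<theta>] cos_pos by (simp add: field_simps)
  qed (use cos_pos in simp)
  finally show ?thesis using cos_pos by (simp add: field_simps)
qed

theorem mainTheorem11:
  fixes A :: "'a::chilbert_space \<Rightarrow> 'a" and \<theta> :: real
  assumes "0 \<le> \<theta>" and "\<theta> < pi / 2"
    and "bounded_clinear A"
    and "numerical_range A \<subseteq> sector \<theta>"
  shows "(\<forall>t::real. 0 \<le> t \<and> t \<le> 1 \<longrightarrow>
           2 * sqrt ((1 - t) ^ 3) * cos \<theta> * onorm A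
           + \<bar>onorm (\<lambda>x. sqrt ((1 - t) ^ 3) *\<^sub>R real_part A x + sqrt (t ^ 3) *\<^sub>R imag_part A x)
              - onorm (\<lambda>x. sqrt ((1 - t) ^ 3) *\<^sub>R real_part A x - sqrt (t ^ 3) *\<^sub>R imag_part A x)\<bar>
           \<le> weighted_numerical_radius t A)
    \<and> cos \<theta> / sqrt 2 * onorm A
         + 1 / (2 * sqrt 2) * \<bar>onorm (\<lambda>x. real_part A x + imag_part A x)
                               - onorm (\<lambda>x. real_part A x - imag_part A x)\<bar>
         \<le> numerical_radius A
    \<and> (\<theta> \<le> pi / 4 \<longrightarrow>
         1 / 2 * onorm A
           \<le> 1 / 2 * onorm A
             + 1 / (2 * sqrt 2) * \<bar>onorm (\<lambda>x. real_part A x + imag_part A x)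
                                   - onorm (\<lambda>x. real_part A x - imag_part A x)\<bar>
       \<and> 1 / 2 * onorm A
             + 1 / (2 * sqrt 2) * \<bar>onorm (\<lambda>x. real_part A x + imag_part A x)
                                   - onorm (\<lambda>x. real_part A x - imag_part A x)\<bar>
           \<le> cos \<theta> / sqrt 2 * onorm A
             + 1 / (2 * sqrt 2) * \<bar>onorm (\<lambda>x. real_part A x + imag_part A x)
                                   - onorm (\<lambda>x. real_part A x - imag_part A x)\<bar>
       \<and> cos \<theta> / sqrt 2 * onorm A
             + 1 / (2 * sqrt 2) * \<bar>onorm (\<lambda>x. real_part A x + imag_part A x)
                                   - onorm (\<lambda>x. real_part A x - imag_part A x)\<bar>
           \<le> numerical_radius A)"
proof -
  let ?R = "real_part A" and ?J = "imag_part A"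
  have main: "2 * sqrt ((1 - t) ^ 3) * cos \<theta> * onorm A
      + \<bar>onorm (\<lambda>x. sqrt ((1 - t) ^ 3) *\<^sub>R ?R x + sqrt (t ^ 3) *\<^sub>R ?J x)
         - onorm (\<lambda>x. sqrt ((1 - t) ^ 3) *\<^sub>R ?R x - sqrt (t ^ 3) *\<^sub>R ?J x)\<bar>
      \<le> weighted_numerical_radius t A" if t: "0 \<le> t" "t \<le> 1" for t :: real
  proof -
    have "2 * sqrt ((1 - t) ^ 3) * (cos \<theta> * onorm A) \<le> 2 * sqrt ((1 - t) ^ 3) * onorm ?R"
      using t by (intro mult_left_mono cos_onorm_le_onorm_real_part assms) auto
    with weighted_numerical_radius_ge[OF assms(3) t] show ?thesis by (simp add: mult.assoc)
  qed
  \<comment> \<open>The common value of both coefficients at \<open>t = 1/2\<close>.\<close>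
  define c :: real where "c = 1 / (2 * sqrt 2)"
  have c: "sqrt ((1/2) ^ 3) = c" "0 < c" "2 * c = 1 / sqrt 2"
    by (auto simp: c_def power_divide power_mult_distrib power3_eq_cube intro!: real_sqrt_unique)
  have lin: "bounded_linear (\<lambda>x. ?R x + ?J x)" "bounded_linear (\<lambda>x. ?R x - ?J x)"
    by (intro bounded_linear_add bounded_linear_sub bounded_linear_real_part
        bounded_linear_imag_part assms)+
  have scaled: "onorm (\<lambda>x. c *\<^sub>R ?R x + c *\<^sub>R ?J x) = c * onorm (\<lambda>x. ?R x + ?J x)"
    "onorm (\<lambda>x. c *\<^sub>R ?R x - c *\<^sub>R ?J x) = c * onorm (\<lambda>x. ?R x - ?J x)"
    using lin[THEN onorm_scaleR, of c] c(2) by (simp_all add: scaleR_add_right scaleR_diff_right)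
  have half: "cos \<theta> / sqrt 2 * onorm A
      + c * \<bar>onorm (\<lambda>x. ?R x + ?J x) - onorm (\<lambda>x. ?R x - ?J x)\<bar> \<le> numerical_radius A"
  proof -
    \<comment> \<open>At \<open>t = 1/2\<close> the weight \<open>1 - 2 * t\<close> of the adjoint
      vanishes, leaving the ordinary numerical radius.\<close>
    have "2 * c * cos \<theta> * onorm A + \<bar>c * onorm (\<lambda>x. ?R x + ?J x) - c * onorm (\<lambda>x. ?R x - ?J x)\<bar>
        \<le> numerical_radius A"
      using main[of "1/2"] by (simp add: c(1) scaled weighted_numerical_radius_def)
    moreover have "\<bar>c * onorm (\<lambda>x. ?R x + ?J x) - c * onorm (\<lambda>x. ?R x - ?J x)\<bar>
        = c * \<bar>onorm (\<lambda>x. ?R x + ?J x) - onorm (\<lambda>x. ?R x - ?J x)\<bar>"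
      using c(2) by (simp add: abs_mult flip: right_diff_distrib)
    ultimately show ?thesis by (simp add: c(3))
  qed
  \<comment> \<open>Cosine decreases on \<open>[0, pi / 4]\<close>, so it is at least its value
    \<open>sqrt 2 / 2\<close> at the right endpoint.\<close>
  have quarter: "1 / 2 * onorm A \<le> cos \<theta> / sqrt 2 * onorm A" if "\<theta> \<le> pi / 4"
  proof (rule mult_right_mono)
    have "sqrt 2 / 2 \<le> cos \<theta>"
      using that assms(1) cos_monotone_0_pi_le[of \<theta> "pi / 4"] by (simp add: cos_45)
    then have "sqrt 2 / 2 / sqrt 2 \<le> cos \<theta> / sqrt 2" by (rule divide_right_mono) simp
    then show "1 / 2 \<le> cos \<theta> / sqrt 2" by simp
    show "0 \<le> onorm A" using assms(3) by (simp add: bounded_clinear_def onorm_pos_le)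
  qed
  show ?thesis
    using main half quarter c(2) unfolding c_def[symmetric] by auto
qed

end
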